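(* Let $r,n\ge 1$ be integers, $A=[r]=\{1,\dots,r\}$, and $s\in\{1,\dots,r\}$. Let $f:A^n\to[0,1]$ be an $s$-compressed fractional family with $|f|\le s^n$, and let $h=b^{(n,s)}_{k,\alpha}$ be a fractional Hamming ball on $A^n$ with $|h|=|f|$. Then $|\Delta f|\ge|\Delta h|$.
   Context: A fractional family on $A^n$ is any function $f:A^n\to[0,1]$; its weight is $|f|=\sum_{w\in A^n}f(w)$. Its deletion shadow is the fractional family $\Delta f$ on $A^{n-1}$ given by $(\Delta f)(x_1,\dots,x_{n-1})=\max_{y\in A,\ i\in[n]} f(x_1,\dots,x_{i-1},y,x_i,\dots,x_{n-1})$ (the maximum over all ways of inserting one letter $y$ at position $i$). For integers $k\ge 0$ and $\alpha\in[0,1]$, the fractional Hamming ball $b^{(n,s)}_{k,\alpha}:A^n\to[0,1]$ takes value $1$ on words of $[s]^n$ containing the symbol $s$ at most $k$ times, value $\alpha$ on words of $[s]^n$ containing the symbol $s$ exactly $k+1$ times, and $0$ on all other words of $A^n$. (For every weight in $[0,s^n]$ there is such a ball of that weight, and the ball as a function is determined by its weight, since e.g. $b_{k-1,1}=b_{k,0}$.) For $\ell\in A$, a fractional family $f$ on $A^n$ is $\ell$-compressed if for all $x_1,\dots,x_n,y\in A$ and $i\in[n]$ with $y<x_i$ and $\ell\le x_i$, $f(x_1,\dots,x_n)>0$ implies $f(x_1,\dots,x_{i-1},y,x_{i+1},\dots,x_n)=1$. *)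

theory Defs
  imports Complex_Main
begin

text \<open>Alphabet A = {1..r}; words of A^n are lists of length n over {1..r}.
A fractional family on A^n is a function on nat lists (only its values on words matter).\<close>

definition words :: "nat \<Rightarrow> nat \<Rightarrow> nat list set" where
  "words r n = {w. length w = n \<and> set w \<subseteq> {1..r}}"

definition weight :: "nat \<Rightarrow> nat \<Rightarrow> (nat list \<Rightarrow> real) \<Rightarrow> real" where
  "weight r n f = (\<Sum>w\<in>words r n. f w)"

definition is_fractional :: "nat \<Rightarrow> nat \<Rightarrow> (nat list \<Rightarrow> real) \<Rightarrow> bool" where
  "is_fractional r n f \<longleftrightarrow> (\<forall>w\<in>words r n. 0 \<le> f w \<and> f w \<le> 1)"

text \<open>Deletion shadow: maximum over all insertions of a letter y in A at a position
(position i in [n] corresponds to inserting after the first i-1 letters).\<close>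
definition shadow :: "nat \<Rightarrow> (nat list \<Rightarrow> real) \<Rightarrow> nat list \<Rightarrow> real" where
  "shadow r f x = Max {f (take i x @ [y] @ drop i x) | i y. i \<le> length x \<and> y \<in> {1..r}}"

definition count_sym :: "nat \<Rightarrow> nat list \<Rightarrow> nat" where
  "count_sym s w = length (filter (\<lambda>c. c = s) w)"

definition hball :: "nat \<Rightarrow> nat \<Rightarrow> real \<Rightarrow> nat list \<Rightarrow> real" where
  "hball s k \<alpha> w =
     (if set w \<subseteq> {1..s} \<and> count_sym s w \<le> k then 1
      else if set w \<subseteq> {1..s} \<and> count_sym s w = k + 1 then \<alpha> else 0)"

definition compressed :: "nat \<Rightarrow> nat \<Rightarrow> nat \<Rightarrow> (nat list \<Rightarrow> real) \<Rightarrow> bool" where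
  "compressed r n l f \<longleftrightarrow>
     (\<forall>w\<in>words r n. \<forall>i<n. \<forall>y\<in>{1..r}.
        y < w ! i \<and> l \<le> w ! i \<and> f w > 0 \<longrightarrow> f (w[i := y]) = 1)"

end

theory Submission
  imports Defs
begin

text \<open>
  Write \<open>f\<^sub>y\<close> for the slice \<open>x \<mapsto> f (y # x)\<close>. Deleting the first letter gives
  \<open>|\<Delta>f| \<ge> |f\<^sub>y|\<close> for every \<open>y\<close>, and deleting a later one gives
  \<open>|\<Delta>f| \<ge> (\<Sum>y. |\<Delta>f\<^sub>y|)\<close>. For \<open>s \<ge> 2\<close>, the shadow of a ball as a function of its weight
  is the concave function \<open>g\<^sub>n m = (\<Sum>j<n. min m V\<^sub>j) / (n (s - 1))\<close>, where \<open>V\<^sub>j\<close> is the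
  number of words of \<open>[s]\<^sup>n\<close> with at most \<open>j\<close> letters \<open>s\<close>. Then \<open>|\<Delta>f| \<ge> g\<^sub>n |f|\<close> follows
  by induction on \<open>n\<close>: let \<open>a\<close> and \<open>b\<close> be the weights of the slices of the ball of weight \<open>|f|\<close> at a
  letter below \<open>s\<close> and at \<open>s\<close>. The shadow of the ball has weight \<open>a\<close>, so either some slice of
  \<open>f\<close> has weight at least \<open>a\<close>, or all are lighter, and by concavity
  \<open>(\<Sum>y. g |f\<^sub>y|) \<ge> (s - 1) * g a + g b = a\<close>. Compression is needed only for \<open>n = 1\<close>.
  For \<open>s = 1\<close>, a compressed family of weight at most 1 lives on the single word \<open>1\<^sup>n\<close>, so it is the
  ball.
\<close>

section \<open>Words and shadows\<close>

lemma finite_words: "finite (words r n)"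
  using finite_lists_length_eq[of "{1..r}" n] by (simp add: words_def conj_commute)

lemma words_0 [simp]: "words r 0 = {[]}"
  by (auto simp: words_def)

lemma Cons_in_words_iff: "y # x \<in> words r (Suc n) \<longleftrightarrow> y \<in> {1..r} \<and> x \<in> words r n"
  by (auto simp: words_def)

lemma words_Suc: "words r (Suc n) = (\<lambda>(y, x). y # x) ` ({1..r} \<times> words r n)"
  by (auto simp: words_def length_Suc_conv image_iff)

lemma weight_0 [simp]: "weight r 0 f = f []"
  by (simp add: weight_def)

lemma weight_Suc: "weight r (Suc n) f = (\<Sum>y\<in>{1..r}. weight r n (\<lambda>x. f (y # x)))"
proof -
  have "inj_on (\<lambda>(y, x). y # x) ({1..r} \<times> words r n)"
    by (auto simp: inj_on_def)
  then show ?thesis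
    by (simp add: weight_def words_Suc sum.reindex sum.cartesian_product case_prod_unfold)
qed

lemma weight_mono: "(\<And>x. x \<in> words r n \<Longrightarrow> f x \<le> g x) \<Longrightarrow> weight r n f \<le> weight r n g"
  unfolding weight_def by (rule sum_mono)

lemma weight_cong: "(\<And>x. x \<in> words r n \<Longrightarrow> f x = g x) \<Longrightarrow> weight r n f = weight r n g"
  unfolding weight_def by (rule sum.cong) auto

lemma weight_nonneg: "is_fractional r n f \<Longrightarrow> 0 \<le> weight r n f"
  unfolding weight_def is_fractional_def by (intro sum_nonneg) auto

lemma insert_in_words:
  assumes "x \<in> words r n" "i \<le> length x" "y \<in> {1..r}"
  shows "take i x @ [y] @ drop i x \<in> words r (Suc n)"
  using assms set_take_subset[of i x] set_drop_subset[of i x] by (auto simp: words_def)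

lemma finite_insertions:
  "finite {f (take i x @ [y] @ drop i x) | i y. i \<le> length x \<and> y \<in> {1..r::nat}}"
proof (rule finite_subset)
  show "{f (take i x @ [y] @ drop i x) | i y. i \<le> length x \<and> y \<in> {1..r}}
      \<subseteq> (\<lambda>(i, y). f (take i x @ [y] @ drop i x)) ` ({..length x} \<times> {1..r})"
    by auto
qed simp

lemma shadow_ge:
  assumes "i \<le> length x" "y \<in> {1..r}"
  shows "f (take i x @ [y] @ drop i x) \<le> shadow r f x"
  unfolding shadow_def using assms by (intro Max_ge finite_insertions) blast

lemma shadow_le:
  assumes "r \<ge> 1"
    and "\<And>i y. i \<le> length x \<Longrightarrow> y \<in> {1..r} \<Longrightarrow> f (take i x @ [y] @ drop i x) \<le> c"
  shows "shadow r f x \<le> c"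
proof -
  have "f (take 0 x @ [1] @ drop 0 x)
      \<in> {f (take i x @ [y] @ drop i x) | i y. i \<le> length x \<and> y \<in> {1..r}}"
    unfolding mem_Collect_eq using assms(1) by (intro exI[of _ "0::nat"] exI[of _ "1::nat"]) auto
  then show ?thesis
    unfolding shadow_def using assms(2) by (subst Max_le_iff[OF finite_insertions]) blast+
qed

lemma shadow_cong:
  assumes "x \<in> words r n" "\<And>w. w \<in> words r (Suc n) \<Longrightarrow> f w = g w"
  shows "shadow r f x = shadow r g x"
proof -
  have "{f (take i x @ [y] @ drop i x) | i y. i \<le> length x \<and> y \<in> {1..r}}
      = {g (take i x @ [y] @ drop i x) | i y. i \<le> length x \<and> y \<in> {1..r}}"
    using assms(2)[OF insert_in_words[OF assms(1)]] by (intro Collect_cong) metis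
  then show ?thesis by (simp add: shadow_def)
qed

lemma weight_slice_le_weight_shadow:
  assumes "y \<in> {1..r}"
  shows "weight r n (\<lambda>x. f (y # x)) \<le> weight r n (shadow r f)"
  using shadow_ge[of 0 _ y r f] assms by (intro weight_mono) auto

text \<open>Inserting a letter after the first one keeps the first letter, so on words starting with
  \<open>y\<close> the shadow of \<open>f\<close> dominates that of the slice at
  \<open>y\<close>.\<close>

lemma sum_weight_shadow_slice_le:
  assumes "r \<ge> 1"
  shows "(\<Sum>y\<in>{1..r}. weight r n (shadow r (\<lambda>x. f (y # x)))) \<le> weight r (Suc n) (shadow r f)"
  unfolding weight_Suc
proof (intro sum_mono weight_mono shadow_le[OF assms])
  fix y z i :: nat and x :: "nat list"
  assume "i \<le> length x" "z \<in> {1..r}"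
  then show "f (y # take i x @ [z] @ drop i x) \<le> shadow r f (y # x)"
    using shadow_ge[of "Suc i" "y # x" z r f] by simp
qed

lemma is_fractional_slice:
  assumes "is_fractional r (Suc n) f" "y \<in> {1..r}"
  shows "is_fractional r n (\<lambda>x. f (y # x))"
  using assms by (auto simp: is_fractional_def Cons_in_words_iff)

lemma compressed_slice:
  assumes "compressed r (Suc n) l f" "y \<in> {1..r}"
  shows "compressed r n l (\<lambda>x. f (y # x))"
  unfolding compressed_def
proof (intro ballI allI impI)
  fix w i z
  assume "w \<in> words r n" "i < n" "z \<in> {1..r}" "z < w ! i \<and> l \<le> w ! i \<and> 0 < f (y # w)"
  then show "f (y # w[i := z]) = 1"
    using assms(1)[unfolded compressed_def, rule_format, of "y # w" "Suc i" z] assms(2)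
    by (auto simp: Cons_in_words_iff)
qed

section \<open>Ball profiles\<close>

text \<open>A profile lists the values of a fractional ball by the number of letters \<open>s\<close>. The paper's
  balls \<open>b\<^bsub>-1,\<alpha>\<^esub>\<close>, absent from \<^const>\<open>hball\<close>, are included: they occur as slices.\<close>

definition profile :: "(nat \<Rightarrow> real) \<Rightarrow> bool" where
  "profile p \<longleftrightarrow> (\<forall>i. 0 \<le> p i \<and> p i \<le> 1 \<and> (0 < p (Suc i) \<longrightarrow> p i = 1))"

lemma profile_antimono: "profile p \<Longrightarrow> antimono p"
  unfolding profile_def by (intro decseq_SucI) (metis not_less order.trans)

lemma profile_eq_0: "profile p \<Longrightarrow> p i \<noteq> 1 \<Longrightarrow> i < j \<Longrightarrow> p j = 0"
proof -
  assume p: "profile p" "p i \<noteq> 1" "i < j"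
  have "0 \<le> p (Suc i)" "\<not> 0 < p (Suc i)" "0 \<le> p j"
    using p(1,2) unfolding profile_def by blast+
  moreover have "p j \<le> p (Suc i)"
    using antimonoD[OF profile_antimono[OF p(1)], of "Suc i" j] p(3) by simp
  ultimately show ?thesis by linarith
qed

lemma profile_Suc: "profile p \<Longrightarrow> profile (\<lambda>i. p (Suc i))"
  by (auto simp: profile_def)

text \<open>The profile equal to 1 up to \<open>k\<close>, to \<open>\<alpha>\<close> at
  \<open>k + 1\<close> and to 0 beyond gives \<open>hball s k \<alpha>\<close>.\<close>

definition spread :: "nat \<Rightarrow> (nat \<Rightarrow> real) \<Rightarrow> nat list \<Rightarrow> real" where
  "spread s p w = (if set w \<subseteq> {1..s} then p (count_sym s w) else 0)"

lemma spread_Cons: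
  assumes "1 \<le> y"
  shows "spread s p (y # x) =
    (if y < s then spread s p x else if y = s then spread s (\<lambda>i. p (Suc i)) x else 0)"
  using assms by (auto simp: spread_def count_sym_def)

text \<open>With \<open>q = s - 1\<close> this is \<open>\<Sum>i\<le>n. (n choose i) * q ^ (n - i) * p i\<close>.\<close>

primrec bw :: "real \<Rightarrow> nat \<Rightarrow> (nat \<Rightarrow> real) \<Rightarrow> real" where
  "bw q 0 p = p 0"
| "bw q (Suc n) p = q * bw q n p + bw q n (\<lambda>i. p (Suc i))"

text \<open>The \<open>s - 1\<close> letters below \<open>s\<close> keep the profile, the letter
  \<open>s\<close> shifts it by one, and larger letters contribute 0; this is the recursion of
  \<open>bw\<close>.\<close>

lemma weight_spread:
  assumes "1 \<le> s" "s \<le> r"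
  shows "weight r n (spread s p) = bw (real (s - 1)) n p"
proof (induction n arbitrary: p)
  case 0
  then show ?case by (simp add: spread_def count_sym_def)
next
  case (Suc n)
  have split: "{1..r} = {1..s-1} \<union> {s} \<union> {s+1..r}"
    using assms by auto
  have "weight r (Suc n) (spread s p)
     = (\<Sum>y\<in>{1..r}. weight r n (\<lambda>x. if y < s then spread s p x
          else if y = s then spread s (\<lambda>i. p (Suc i)) x else 0))"
    unfolding weight_Suc by (intro sum.cong refl weight_cong) (simp add: spread_Cons)
  also have "\<dots> = (\<Sum>y\<in>{1..s-1}. weight r n (spread s p)) + weight r n (spread s (\<lambda>i. p (Suc i)))"
  proof -
    have "(\<Sum>y\<in>{1..s-1}. weight r n (\<lambda>x. if y < s then spread s p x
        else if y = s then spread s (\<lambda>i. p (Suc i)) x else 0)) = (\<Sum>y\<in>{1..s-1}. weight r n (spread s p))"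
      by (intro sum.cong refl weight_cong) auto
    moreover have "(\<Sum>y\<in>{s+1..r}. weight r n (\<lambda>x. if y < s then spread s p x
        else if y = s then spread s (\<lambda>i. p (Suc i)) x else 0)) = 0"
      by (intro sum.neutral) (auto simp: weight_def)
    ultimately show ?thesis
      unfolding split using assms(1) by (subst sum.union_disjoint; auto)+
  qed
  finally show ?case by (simp add: Suc)
qed

lemma bw_cong: "(\<And>i. i \<le> n \<Longrightarrow> p i = p' i) \<Longrightarrow> bw q n p = bw q n p'"
proof (induction n arbitrary: p p')
  case (Suc n)
  have "bw q n p = bw q n p'" "bw q n (\<lambda>i. p (Suc i)) = bw q n (\<lambda>i. p' (Suc i))"
    using Suc.prems by (auto intro!: Suc.IH)
  then show ?case by simp
qed simp

lemma bw_mono: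
  assumes "0 \<le> q" "\<And>i. i \<le> n \<Longrightarrow> p i \<le> p' i"
  shows "bw q n p \<le> bw q n p'"
  using assms(2)
proof (induction n arbitrary: p p')
  case (Suc n)
  have "bw q n p \<le> bw q n p'" "bw q n (\<lambda>i. p (Suc i)) \<le> bw q n (\<lambda>i. p' (Suc i))"
    using Suc.prems by (auto intro!: Suc.IH)
  then show ?case using assms(1) by (simp add: add_mono mult_left_mono)
qed simp

lemma bw_add: "bw q n (\<lambda>i. p i + p' i) = bw q n p + bw q n p'"
  by (induction n arbitrary: p p') (simp_all add: algebra_simps)

lemma bw_scale: "bw q n (\<lambda>i. c * p i) = c * bw q n p"
  by (induction n arbitrary: p) (simp_all add: algebra_simps)

lemma bw_zero [simp]: "bw q n (\<lambda>i. 0) = 0"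
  by (induction n) (simp_all)

lemma bw_sum: "bw q n (\<lambda>i. \<Sum>j\<in>J. P j i) = (\<Sum>j\<in>J. bw q n (P j))"
  by (induction J rule: infinite_finite_induct) (simp_all add: bw_add)

text \<open>Summed over layers: \<open>(n - i) * (n choose i) = n * (n - 1 choose i)\<close>.\<close>

lemma bw_co_count:
  "bw q (Suc n) (\<lambda>i. (real (Suc n) - real i) * p i) = real (Suc n) * q * bw q n p"
proof (induction n arbitrary: p)
  case 0
  then show ?case by simp
next
  case (Suc n)
  \<comment> \<open>One unit of the factor is split off to reach the induction hypothesis; in the
    shifted term below, the index shift itself lowers the factor by one.\<close>
  have "bw q (Suc n) (\<lambda>i. (real (Suc (Suc n)) - real i) * p i)
      = bw q (Suc n) (\<lambda>i. (real (Suc n) - real i) * p i + p i)"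
    by (simp add: algebra_simps)
  then have 1: "bw q (Suc n) (\<lambda>i. (real (Suc (Suc n)) - real i) * p i)
      = real (Suc n) * q * bw q n p + bw q (Suc n) p"
    unfolding bw_add Suc.IH .
  have "(\<lambda>i. (real (Suc (Suc n)) - real (Suc i)) * p (Suc i))
      = (\<lambda>i. (real (Suc n) - real i) * p (Suc i))"
    by (auto simp: fun_eq_iff)
  then have 2: "bw q (Suc n) (\<lambda>i. (real (Suc (Suc n)) - real (Suc i)) * p (Suc i))
      = real (Suc n) * q * bw q n (\<lambda>i. p (Suc i))"
    using Suc.IH[of "\<lambda>i. p (Suc i)"] by (simp only:)
  show ?case
    unfolding bw.simps(2)[of q "Suc n"] 1 2 by (simp add: algebra_simps)
qed

lemma ex_profile:
  assumes "0 \<le> q" "0 \<le> m" "m \<le> bw q n (\<lambda>i. of_bool (i < J))"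
  shows "\<exists>p. profile p \<and> bw q n p = m"
  using assms(3)
proof (induction J)
  case 0
  then show ?case
    using assms(2) by (intro exI[of _ "\<lambda>i. 0"]) (simp add: profile_def)
next
  case (Suc J)
  define u v where "u = bw q n (\<lambda>i. of_bool (i < J))" and "v = bw q n (\<lambda>i. of_bool (i < Suc J))"
  show ?case
  proof (cases "m \<le> u")
    case True
    then show ?thesis using Suc.IH by (simp add: u_def)
  next
    case False
    then have uv: "u < m" "m \<le> v" using Suc.prems by (auto simp: v_def)
    define t where "t = (m - u) / (v - u)"
    have t: "0 \<le> t" "t \<le> 1" using uv by (auto simp: t_def)
    define p where "p i = (1 - t) * of_bool (i < J) + t * of_bool (i < Suc J)" for i
    have "profile p" using t by (auto simp: profile_def p_def)
    moreover have "bw q n p = (1 - t) * u + t * v"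
      unfolding p_def bw_add bw_scale u_def v_def ..
    moreover have "(1 - t) * u + t * v = u + t * (v - u)"
      by (simp add: algebra_simps)
    moreover have "\<dots> = m" using uv by (simp add: t_def)
    ultimately show ?thesis by metis
  qed
qed

section \<open>The shadow of a ball as a function of its weight\<close>

text \<open>Written as a sum of truncations, so that monotonicity and concavity in \<open>m\<close>
  come from those of \<open>min\<close>.\<close>

definition ball_shadow :: "real \<Rightarrow> nat \<Rightarrow> real \<Rightarrow> real" where
  "ball_shadow q n m = (\<Sum>j<n. min m (bw q n (\<lambda>i. of_bool (i \<le> j)))) / (real n * q)"

lemma ball_shadow_0:
  assumes "0 \<le> q"
  shows "ball_shadow q n 0 = 0"
proof -
  have "0 \<le> bw q n (\<lambda>i. of_bool (i \<le> j))" for j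
    using bw_mono[OF assms, of n "\<lambda>i. 0" "\<lambda>i. of_bool (i \<le> j)"] by simp
  then show ?thesis by (simp add: ball_shadow_def min_def)
qed

lemma ball_shadow_mono: "0 \<le> q \<Longrightarrow> mono (ball_shadow q n)"
  unfolding ball_shadow_def
  by (intro monoI divide_right_mono sum_mono) auto

lemma ball_shadow_concave:
  assumes "0 \<le> q" "b \<le> x" "x \<le> a"
  shows "ball_shadow q n a + ball_shadow q n b \<le> ball_shadow q n x + ball_shadow q n (a + b - x)"
  unfolding ball_shadow_def add_divide_distrib[symmetric] sum.distrib[symmetric]
  using assms by (intro divide_right_mono sum_mono) auto

text \<open>Capping the weight at that of the layers up to \<open>j\<close> cuts the profile off
  after \<open>j\<close>. Summing over \<open>j < Suc n\<close> counts layer \<open>i\<close>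
  exactly \<open>Suc n - i\<close> times, which \<open>bw_co_count\<close> evaluates.\<close>

lemma ball_shadow_bw:
  assumes "0 < q" "profile p"
  shows "ball_shadow q (Suc n) (bw q (Suc n) p) = bw q n p"
proof -
  let ?N = "Suc n"
  have p01: "0 \<le> p i" "p i \<le> 1" for i using assms(2) by (auto simp: profile_def)
  have *: "min (bw q ?N p) (bw q ?N (\<lambda>i. of_bool (i \<le> j))) = bw q ?N (\<lambda>i. of_bool (i \<le> j) * p i)"
    \<comment> \<open>Either all layers up to \<open>j\<close> are full, or the ball has nothing
      beyond layer \<open>j\<close>.\<close>
    for j
  proof (cases "\<forall>i\<le>j. p i = 1")
    case True
    then have "(\<lambda>i. of_bool (i \<le> j) * p i) = (\<lambda>i. of_bool (i \<le> j))" by auto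
    moreover have "bw q ?N (\<lambda>i. of_bool (i \<le> j)) \<le> bw q ?N p"
      using True p01 assms(1) by (intro bw_mono) auto
    ultimately show ?thesis by simp
  next
    case False
    then obtain i\<^sub>0 where i0: "i\<^sub>0 \<le> j" "p i\<^sub>0 \<noteq> 1" by auto
    then have 0: "p i = 0" if "j < i" for i
      using profile_eq_0[OF assms(2) i0(2), of i] that by simp
    then have eq: "of_bool (i \<le> j) * p i = p i" and le: "p i \<le> of_bool (i \<le> j)" for i
      using p01[of i] by (cases "i \<le> j"; simp)+
    have "(\<lambda>i. of_bool (i \<le> j) * p i) = p" using eq by blast
    moreover have "bw q ?N p \<le> bw q ?N (\<lambda>i. of_bool (i \<le> j))"
      using assms(1) le by (intro bw_mono) auto
    ultimately show ?thesis by simp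
  qed
  have "(\<Sum>j<?N. min (bw q ?N p) (bw q ?N (\<lambda>i. of_bool (i \<le> j))))
      = bw q ?N (\<lambda>i. \<Sum>j<?N. of_bool (i \<le> j) * p i)"
    unfolding * bw_sum ..
  also have "\<dots> = bw q ?N (\<lambda>i. (real ?N - real i) * p i)"
  proof (rule bw_cong)
    fix i assume i: "i \<le> ?N"
    have "{..<?N} \<inter> {j. i \<le> j} = {i..<?N}" by auto
    then have "(\<Sum>j<?N. of_bool (i \<le> j)) = real (?N - i)"
      by (simp only: sum_of_bool_eq finite_lessThan card_atLeastLessThan)
    then show "(\<Sum>j<?N. of_bool (i \<le> j) * p i) = (real ?N - real i) * p i"
      using i by (simp only: sum_distrib_right[symmetric] of_nat_diff)
  qed
  also have "\<dots> = real ?N * q * bw q n p" by (rule bw_co_count)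
  finally show ?thesis
    using assms(1) unfolding ball_shadow_def by (simp del: of_nat_Suc)
qed

text \<open>No truncation level exceeds the weight of all layers together. Any nonnegative
  \<open>m\<close> can thus be replaced by a weight that a ball attains.\<close>

lemma ball_shadow_min:
  assumes "0 \<le> q"
  shows "ball_shadow q n (min m (bw q n (\<lambda>i. 1))) = ball_shadow q n m"
proof -
  have "bw q n (\<lambda>i. of_bool (i \<le> j)) \<le> bw q n (\<lambda>i. 1)" for j
    using assms by (intro bw_mono) auto
  then show ?thesis
    unfolding ball_shadow_def by (intro arg_cong2[where f = "(/)"] sum.cong refl)
      (simp add: min.absorb2 min.assoc)
qed

text \<open>Among points of \<open>[0, M]\<close> with a given sum, a concave function has the least sum when all
  points but one are at the ends.\<close>

lemma sum_concave_ge: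
  fixes g :: "real \<Rightarrow> real" and x :: "'a \<Rightarrow> real"
  assumes "finite I" "g 0 = 0" "mono g"
    and conc: "\<And>a b x. b \<le> x \<Longrightarrow> x \<le> a \<Longrightarrow> g a + g b \<le> g x + g (a + b - x)"
    and "\<And>i. i \<in> I \<Longrightarrow> 0 \<le> x i \<and> x i \<le> M" "0 \<le> c" "c \<le> M" "real k * M + c \<le> (\<Sum>i\<in>I. x i)"
  shows "real k * g M + g c \<le> (\<Sum>i\<in>I. g (x i))"
  using assms(1,5-)
proof (induction I arbitrary: k c rule: finite_induct)
  case empty
  then have "0 \<le> real k * M" "real k * M + c \<le> 0" by simp_all
  then have "c = 0" "real k * M = 0" using empty by linarith+
  then show ?case using \<open>g 0 = 0\<close> by auto
next
  case (insert i I)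
  have xi: "0 \<le> x i" "x i \<le> M" and xI: "\<And>j. j \<in> I \<Longrightarrow> 0 \<le> x j \<and> x j \<le> M"
    using insert.prems(1) by auto
  have sum: "real k * M + c \<le> x i + (\<Sum>j\<in>I. x j)" using insert.prems(4) insert.hyps by simp
  have cM: "0 \<le> c" "c \<le> M" using insert.prems by auto
  have "real k * g M + g c \<le> g (x i) + (\<Sum>j\<in>I. g (x j))"
  proof (cases "x i \<le> c")
    case True
    \<comment> \<open>\<open>x i\<close> and \<open>c - x i\<close> are spread out to
      \<open>c\<close> and 0, so the other points only have to account for the remainder
      \<open>c - x i\<close>.\<close>
    have "real k * g M + g (c - x i) \<le> (\<Sum>j\<in>I. g (x j))"
      using True xi sum cM by (intro insert.IH xI) linarith+
    moreover have "g c + g 0 \<le> g (x i) + g (c + 0 - x i)"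
      using True xi by (intro conc) auto
    ultimately show ?thesis using \<open>g 0 = 0\<close> by simp
  next
    case False
    show ?thesis
    proof (cases k)
      case 0
      have "0 \<le> g (x j)" if "j \<in> I" for j
        using monoD[OF \<open>mono g\<close>, of 0 "x j"] xI[OF that] \<open>g 0 = 0\<close> by simp
      then have "0 \<le> (\<Sum>j\<in>I. g (x j))" by (intro sum_nonneg)
      moreover have "g c \<le> g (x i)" using False by (intro monoD[OF \<open>mono g\<close>]) simp
      ultimately show ?thesis using 0 by simp
    next
      case (Suc k')
      \<comment> \<open>As \<open>x i\<close> exceeds \<open>c\<close>, one of the \<open>k\<close>
        copies of \<open>M\<close> is used up: \<open>x i\<close> and \<open>M + c - x i\<close> are
        spread out to \<open>M\<close> and \<open>c\<close>.\<close>
      have "real k' * g M + g (M + c - x i) \<le> (\<Sum>j\<in>I. g (x j))"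
        using False xi sum cM unfolding Suc of_nat_Suc distrib_right
        by (intro insert.IH xI) linarith+
      moreover have "g M + g c \<le> g (x i) + g (M + c - x i)"
        using False xi by (intro conc) auto
      ultimately show ?thesis using Suc by (simp add: algebra_simps)
    qed
  qed
  then show ?case using insert.hyps by simp
qed

section \<open>The lower bound for compressed families\<close>

text \<open>A positive value at a letter from \<open>s\<close> on forces \<open>f [1] = 1\<close> by
  compression, so the shadow is at least 1. Otherwise only \<open>s - 1\<close> letters carry
  weight, each at most the shadow.\<close>

lemma weight_shadow_ge_length_1:
  assumes "2 \<le> s" "s \<le> r" "is_fractional r 1 f" "compressed r 1 s f"
  shows "ball_shadow (real (s - 1)) 1 (weight r 1 f) \<le> shadow r f []"
proof -
  define q where "q = real (s - 1)"
  have q: "0 < q" using assms(1) by (simp add: q_def)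
  have bound: "ball_shadow q 1 m = min m q / q" for m
    by (simp add: ball_shadow_def)
  have le: "f [y] \<le> shadow r f []" if "y \<in> {1..r}" for y
    using shadow_ge[of 0 "[]" y r f] that by simp
  have word: "[y] \<in> words r 1" if "y \<in> {1..r}" for y using that by (simp add: words_def)
  have "min (weight r 1 f) q \<le> q * shadow r f []"
  proof (cases "\<exists>y\<in>{s..r}. 0 < f [y]")
    case True
    then obtain y where y: "y \<in> {s..r}" "0 < f [y]" by auto
    then have "f [1] = 1"
      using assms(1,2) assms(4)[unfolded compressed_def, rule_format, of "[y]" 0 1] word[of y] by auto
    then have "1 \<le> shadow r f []" using le[of 1] assms(1,2) by simp
    then show ?thesis using q by (simp add: min.coboundedI2)
  next
    case False
    then have 0: "f [y] = 0" if "y \<in> {s..r}" for y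
    proof -
      have "0 \<le> f [y]" using assms(1,3) that word[of y] by (simp add: is_fractional_def)
      then show ?thesis using False that by force
    qed
    have "weight r 1 f = (\<Sum>y\<in>{1..r}. f [y])" by (simp add: weight_Suc)
    also have "\<dots> = (\<Sum>y\<in>{1..s-1}. f [y])"
      using 0 assms(2) by (intro sum.mono_neutral_right) auto
    also have "\<dots> \<le> (\<Sum>y\<in>{1..s-1}. shadow r f [])"
      using le assms(2) by (intro sum_mono) auto
    finally show ?thesis by (simp add: q_def)
  qed
  then show ?thesis
    using q unfolding bound[unfolded q_def] q_def by (simp add: divide_le_eq mult.commute)
qed

lemma weight_shadow_ge:
  assumes "2 \<le> s" "s \<le> r" "is_fractional r (Suc n) f" "compressed r (Suc n) s f"
  shows "ball_shadow (real (s - 1)) (Suc n) (weight r (Suc n) f) \<le> weight r n (shadow r f)"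
  using assms(3,4)
proof (induction n arbitrary: f)
  case 0
  then show ?case using weight_shadow_ge_length_1[OF assms(1,2)] by simp
next
  case (Suc n)
  define q where "q = real (s - 1)"
  have q: "0 < q" using assms(1) by (simp add: q_def)
  let ?F = "\<lambda>y x. f (y # x)"
  define m where "m = weight r (Suc (Suc n)) f"
  let ?top = "bw q (Suc (Suc n)) (\<lambda>i. 1)"
  have "0 \<le> ?top" using bw_mono[of q "Suc (Suc n)" "\<lambda>i. 0" "\<lambda>i. 1"] q by (simp del: bw.simps)
  then have m0: "0 \<le> min m ?top" using weight_nonneg[OF Suc.prems(1)] by (simp add: m_def)
  \<comment> \<open>A word of length \<open>n + 2\<close> has between 0 and \<open>n + 2\<close>
    letters \<open>s\<close>, hence \<open>n + 3\<close> layers.\<close>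
  have "?top = bw q (Suc (Suc n)) (\<lambda>i. of_bool (i < Suc (Suc (Suc n))))"
    by (rule bw_cong) simp
  then obtain p where p: "profile p" "bw q (Suc (Suc n)) p = min m ?top"
    using ex_profile[of q "min m ?top" "Suc (Suc n)"] m0 q by (metis less_imp_le min.cobounded2)
  define a b where "a = bw q (Suc n) p" and "b = bw q (Suc n) (\<lambda>i. p (Suc i))"
  have p_nonneg: "0 \<le> p i" for i using p(1) by (simp add: profile_def)
  have target: "ball_shadow q (Suc (Suc n)) m = a"
    using ball_shadow_bw[OF q p(1), of "Suc n"] ball_shadow_min[of q "Suc (Suc n)" m] q p(2)
    by (simp add: a_def)
  \<comment> \<open>Only an inequality, since \<open>m\<close> may exceed \<open>?top\<close> and
    \<open>p\<close> realises the minimum of the two.\<close>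
  have ab: "q * a + b \<le> m" using p(2) by (simp add: a_def b_def)
  have b: "0 \<le> b" "b \<le> a"
  proof -
    have "bw q (Suc n) (\<lambda>i. 0) \<le> b"
      unfolding b_def using q p_nonneg by (intro bw_mono) auto
    then show "0 \<le> b" by (simp only: bw_zero)
    show "b \<le> a"
      unfolding a_def b_def using q
      by (intro bw_mono antimonoD[OF profile_antimono[OF p(1)]]) auto
  qed
  have slice: "is_fractional r (Suc n) (?F y)" "compressed r (Suc n) s (?F y)" if "y \<in> {1..r}" for y
    using is_fractional_slice compressed_slice Suc.prems that by blast+
  have "a \<le> weight r (Suc n) (shadow r f)"
  proof (cases "\<exists>y\<in>{1..r}. a \<le> weight r (Suc n) (?F y)")
    case True
    then show ?thesis using weight_slice_le_weight_shadow order.trans by blast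
  next
    case False
    \<comment> \<open>The ball of weight \<open>a\<close> is split by its first letter;
      \<open>ball_shadow_bw\<close> turns the two terms into ball shadows of the weights
      \<open>a\<close> and \<open>b\<close>.\<close>
    have "a = q * bw q n p + bw q n (\<lambda>i. p (Suc i))" by (simp add: a_def)
    also have "\<dots> = real (s - 1) * ball_shadow q (Suc n) a + ball_shadow q (Suc n) b"
      using ball_shadow_bw[OF q p(1)] ball_shadow_bw[OF q profile_Suc[OF p(1)]]
      unfolding a_def b_def by (simp only: q_def)
    also have "\<dots> \<le> (\<Sum>y\<in>{1..r}. ball_shadow q (Suc n) (weight r (Suc n) (?F y)))"
    proof (rule sum_concave_ge[OF _ ball_shadow_0 ball_shadow_mono ball_shadow_concave])
      show "0 \<le> weight r (Suc n) (?F y) \<and> weight r (Suc n) (?F y) \<le> a" if "y \<in> {1..r}" for y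
        using False that weight_nonneg[OF slice(1)[OF that]] by force
      show "real (s - 1) * a + b \<le> (\<Sum>y\<in>{1..r}. weight r (Suc n) (?F y))"
        using ab by (simp only: m_def q_def weight_Suc[of r "Suc n"])
    qed (use q b in simp_all)
    also have "\<dots> \<le> (\<Sum>y\<in>{1..r}. weight r n (shadow r (?F y)))"
      using Suc.IH slice by (intro sum_mono) (simp add: q_def)
    also have "\<dots> \<le> weight r (Suc n) (shadow r f)"
      using assms(1,2) by (intro sum_weight_shadow_slice_le) simp
    finally show ?thesis .
  qed
  then show ?case using target by (simp add: q_def m_def)
qed

section \<open>The shadow of the ball, the case \<open>s = 1\<close> and the comparison\<close>

text \<open>Inserting a letter can neither remove a letter above \<open>s\<close> nor lower the
  number of letters \<open>s\<close>, and profiles are antitone.\<close>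

lemma shadow_spread_le:
  assumes "r \<ge> 1" "profile p"
  shows "shadow r (spread s p) x \<le> spread s p x"
proof (rule shadow_le[OF assms(1)])
  fix i y
  let ?w = "take i x @ [y] @ drop i x"
  have "set ?w = insert y (set (take i x @ drop i x))" unfolding set_append by simp
  then have set: "set ?w = insert y (set x)" by simp
  have "count_sym s ?w = (if y = s then 1 else 0) + count_sym s (take i x @ drop i x)"
    by (simp add: count_sym_def del: append_take_drop_id)
  then have "count_sym s x \<le> count_sym s ?w" by simp
  then have "p (count_sym s ?w) \<le> p (count_sym s x)"
    using antimonoD[OF profile_antimono[OF assms(2)]] by blast
  then show "spread s p ?w \<le> spread s p x"
    using assms(2) unfolding spread_def set by (auto simp: profile_def)
qed

text \<open>If \<open>f\<close> were positive at a word other than \<open>1^n\<close>, lowering one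
  of its letters to 1 would give a second word of value 1 and a total above 1. The ball also lives
  on \<open>1^n\<close>, so equal weights make the two agree.\<close>

lemma eq_hball_of_compressed_1:
  assumes "r \<ge> 1" "is_fractional r n f" "compressed r n 1 f" "weight r n f \<le> 1"
    and "weight r n (hball 1 k \<alpha>) = weight r n f" and "w \<in> words r n"
  shows "f w = hball 1 k \<alpha> w"
proof -
  let ?u = "replicate n (1::nat)"
  have u: "?u \<in> words r n" using assms(1) by (auto simp: words_def)
  have f0: "f w = 0" if w: "w \<in> words r n" "w \<noteq> ?u" for w
  proof (rule ccontr)
    assume "f w \<noteq> 0"
    then have pos: "0 < f w" using assms(2) w by (force simp: is_fractional_def)
    have len: "length w = n" using w by (simp add: words_def)
    obtain i where i: "i < n" "w ! i \<noteq> 1"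
      using w by (auto simp: words_def list_eq_iff_nth_eq)
    moreover have "w ! i \<in> {1..r}"
      using i nth_mem[of i w] len w(1) by (simp add: words_def subset_iff)
    ultimately have wi: "1 < w ! i" by simp
    define v where "v = w[i := 1]"
    have fv: "f v = 1"
      using assms(3)[unfolded compressed_def, rule_format, of w i 1] w i wi pos assms(1)
      by (simp add: v_def)
    have "v ! i = 1" using i len by (simp add: v_def)
    then have "v \<noteq> w" using i by metis
    moreover have "v \<in> words r n"
      using set_update_subset_insert[of w i 1] w(1) assms(1) by (auto simp: words_def v_def)
    ultimately have v: "v \<in> words r n" "v \<noteq> w" by simp_all
    have "f v + f w = (\<Sum>x\<in>{v, w}. f x)" using v by simp
    also have "\<dots> \<le> weight r n f"
      unfolding weight_def using v w assms(2)
      by (intro sum_mono2 finite_words) (auto simp: is_fractional_def)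
    finally show False using fv pos assms(4) by simp
  qed
  have h0: "hball 1 k \<alpha> w = 0" if "w \<in> words r n" "w \<noteq> ?u" for w
  proof -
    have "\<not> set w \<subseteq> {1..1}"
    proof
      assume "set w \<subseteq> {1..1}"
      then have "w = replicate (length w) 1" by (intro replicate_eqI) auto
      then show False using that by (simp add: words_def)
    qed
    then show ?thesis by (simp add: hball_def)
  qed
  have at_u: "weight r n g = g ?u" if "\<And>w. w \<in> words r n \<Longrightarrow> w \<noteq> ?u \<Longrightarrow> g w = 0" for g
    unfolding weight_def using u that finite_words[of r n]
    by (subst sum.mono_neutral_right[of _ "{?u}"]) auto
  show ?thesis
    using at_u[OF f0] at_u[OF h0] f0 h0 assms(5,6) by (cases "w = ?u") auto
qed

theorem theorem4:
  fixes r n s k :: nat and \<alpha> :: real and f :: "nat list \<Rightarrow> real"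
  assumes "r \<ge> 1" and "n \<ge> 1" and "s \<in> {1..r}"
    and "is_fractional r n f"
    and "compressed r n s f"
    and "weight r n f \<le> real s ^ n"
    and "0 \<le> \<alpha>" and "\<alpha> \<le> 1"
    and "weight r n (hball s k \<alpha>) = weight r n f"
  shows "weight r (n - 1) (shadow r f) \<ge> weight r (n - 1) (shadow r (hball s k \<alpha>))"
proof -
  obtain N where n: "n = Suc N" using assms(2) by (cases n) auto
  show ?thesis
  \<comment> \<open>For \<open>s = 1\<close> the parameter \<open>q\<close> is 0 and
    \<open>ball_shadow\<close> would divide by it, hence the separate case.\<close>
  proof (cases "s = 1")
    case True
    then have "f w = hball s k \<alpha> w" if "w \<in> words r n" for w
      using eq_hball_of_compressed_1[of r n f k \<alpha> w] assms that by simp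
    then have "weight r N (shadow r f) = weight r N (shadow r (hball s k \<alpha>))"
      using n by (intro weight_cong shadow_cong) auto
    then show ?thesis by (simp add: n)
  next
    case False
    then have s: "2 \<le> s" "1 \<le> s" "s \<le> r" using assms(3) by auto
    define q where "q = real (s - 1)"
    have q: "0 < q" using s by (simp add: q_def)
    define p where "p i = (if i \<le> k then 1 else if i = k + 1 then \<alpha> else 0)" for i
    have h: "hball s k \<alpha> = spread s p"
      by (auto simp: fun_eq_iff hball_def spread_def p_def)
    have p: "profile p" using assms(7,8) by (auto simp: profile_def p_def)
    have "weight r N (shadow r (hball s k \<alpha>)) \<le> weight r N (spread s p)"
      unfolding h by (intro weight_mono shadow_spread_le assms(1) p)
    also have "\<dots> = ball_shadow q (Suc N) (weight r (Suc N) (spread s p))"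
      unfolding weight_spread[OF s(2,3)] q_def[symmetric] ball_shadow_bw[OF q p] ..
    also have "\<dots> = ball_shadow q (Suc N) (weight r (Suc N) f)"
      using assms(9) by (simp add: h n)
    also have "\<dots> \<le> weight r N (shadow r f)"
      unfolding q_def using weight_shadow_ge[OF s(1,3)] assms(4,5) n by simp
    finally show ?thesis by (simp add: n)
  qed
qed

end
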